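(* Let $s$ and $L$ be positive integers. Then, as formal power series in $q$, $$G_{L,s}(q) = \frac{H_{L,s,L}(q)}{1-q^L}.$$
   Context: For an indeterminate $a$ and positive integer $n$, $(a;q)_n := (1-a)(1-aq)\cdots(1-aq^{n-1})$. A partition $\pi$ is a finite weakly decreasing sequence of positive integers (its parts); $|\pi|$ is the sum of its parts, $s(\pi)$ its smallest part and $l(\pi)$ its largest part. For positive integers $L,s$, $$G_{L,s}(q) := \sum_{\substack{\pi \text{ nonempty},\ s(\pi)=s,\\ l(\pi)-s(\pi)\le L}} q^{|\pi|} \;-\; \sum_{\substack{\pi \text{ nonempty},\ s(\pi)\ge s+1,\\ l(\pi)-s(\pi)\le L}} q^{|\pi|},$$ and for positive integers $L,s,k$, $$H_{L,s,k}(q) := \frac{q^s(1-q^k)}{(q^s;q)_{L+1}} - \left(\frac{1}{(q^{s+1};q)_L}-1\right).$$ *)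

theory Defs
  imports "HOL-Analysis.Infinite_Sum" "HOL-Computational_Algebra.Formal_Power_Series"
begin

definition qpoch :: "'a::comm_ring_1 \<Rightarrow> 'a \<Rightarrow> nat \<Rightarrow> 'a" where
  "qpoch a q n = (\<Prod>i<n. 1 - a * q ^ i)"

definition partitions :: "nat list set" where
  "partitions = {\<pi>. sorted_wrt (\<ge>) \<pi> \<and> (\<forall>x\<in>set \<pi>. 0 < x)}"

text \<open>The smallest and the largest part; they are meaningful for nonempty partitions only.\<close>

definition smallest_part :: "nat list \<Rightarrow> nat" where
  "smallest_part \<pi> = Min (set \<pi>)"

definition largest_part :: "nat list \<Rightarrow> nat" where
  "largest_part \<pi> = Max (set \<pi>)"

text \<open>The generating function is the infinite sum with respect to the \<open>X\<close>-adic metric on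
  formal power series. The lemmas below show that this sum converges for every set of partitions,
  so that \<^const>\<open>infsum\<close> never takes its default value, and they identify its coefficients.\<close>

definition partition_gf :: "nat list set \<Rightarrow> rat fps" where
  "partition_gf A = (\<Sum>\<^sub>\<infinity>\<pi>\<in>A. fps_X ^ sum_list \<pi>)"

definition G :: "nat \<Rightarrow> nat \<Rightarrow> rat fps" where
  "G L s =
     partition_gf {\<pi>\<in>partitions. \<pi> \<noteq> [] \<and> smallest_part \<pi> = s
                      \<and> largest_part \<pi> - smallest_part \<pi> \<le> L}
   - partition_gf {\<pi>\<in>partitions. \<pi> \<noteq> [] \<and> smallest_part \<pi> \<ge> s + 1
                      \<and> largest_part \<pi> - smallest_part \<pi> \<le> L}"

text \<open>For \<open>s > 0\<close> all denominators have constant coefficient \<open>1\<close>, so the divisions are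
  multiplications by genuine inverses.\<close>

definition H :: "nat \<Rightarrow> nat \<Rightarrow> nat \<Rightarrow> rat fps" where
  "H L s k =
     fps_X ^ s * (1 - fps_X ^ k) / qpoch (fps_X ^ s) fps_X (L + 1)
   - (1 / qpoch (fps_X ^ (s + 1)) fps_X L - 1)"

lemma finite_partitions_of: "finite {\<pi>\<in>partitions. sum_list \<pi> = n}"
proof (rule finite_subset)
  have "length \<pi> \<le> sum_list \<pi>" if "\<forall>x\<in>set \<pi>. 0 < x" for \<pi> :: "nat list"
    using that by (induction \<pi>) auto
  thus "{\<pi>\<in>partitions. sum_list \<pi> = n} \<subseteq> {\<pi>. set \<pi> \<subseteq> {..n} \<and> length \<pi> \<le> n}"
    by (auto simp: partitions_def member_le_sum_list)
  show "finite {\<pi>. set \<pi> \<subseteq> {..n} \<and> length \<pi> \<le> n}"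
    by (rule finite_lists_length_le) simp
qed

lemma has_sum_partition_gf:
  assumes "A \<subseteq> partitions"
  shows "((\<lambda>\<pi>. fps_X ^ sum_list \<pi> :: rat fps) has_sum
            Abs_fps (\<lambda>n. of_nat (card {\<pi>\<in>A. sum_list \<pi> = n}))) A"
proof (rule has_sum_fpsI)
  fix n
  have eq: "{\<pi>\<in>A. fps_nth (fps_X ^ sum_list \<pi> :: rat fps) n \<noteq> 0} = {\<pi>\<in>A. sum_list \<pi> = n}"
    by (auto simp: fps_X_power_nth)
  show "finite {\<pi>\<in>A. fps_nth (fps_X ^ sum_list \<pi> :: rat fps) n \<noteq> 0}"
    unfolding eq by (rule finite_subset[OF _ finite_partitions_of[of n]]) (use assms in auto)
  show "fps_nth (Abs_fps (\<lambda>n. of_nat (card {\<pi>\<in>A. sum_list \<pi> = n}))) n =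
      (\<Sum>\<pi> | \<pi> \<in> A \<and> fps_nth (fps_X ^ sum_list \<pi> :: rat fps) n \<noteq> 0.
         fps_nth (fps_X ^ sum_list \<pi> :: rat fps) n)"
    unfolding eq by (simp add: fps_X_power_nth)
qed

lemma fps_nth_partition_gf:
  assumes "A \<subseteq> partitions"
  shows "fps_nth (partition_gf A) n = of_nat (card {\<pi>\<in>A. sum_list \<pi> = n})"
  using infsumI[OF has_sum_partition_gf[OF assms]] by (simp add: partition_gf_def)

end

theory Submission
  imports Defs
begin

text \<open>Let \<open>P a n\<close> (formally \<open>partitions_within {a..<a+n}\<close>) be the set of partitions with all parts in \<open>{a..<a+n}\<close>; its generating function is
  \<open>1 / (q^a; q)_n\<close>. The partitions with smallest part \<open>j\<close> and spread at most \<open>L\<close> are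
  \<open>P j (L + 1) - P (j + 1) L\<close>, so their generating function \<open>D j\<close> is \<open>q^j / (q^j; q)_(L+1)\<close>, and
  \<open>(1 - q^L) D j = 1 / (q^j; q)_L - 1 / (q^(j+1); q)_L\<close>. Summing over \<open>j > s\<close> telescopes, because
  \<open>1 / (q^j; q)_L\<close> tends to \<open>1\<close>.\<close>

definition partitions_within :: "nat set \<Rightarrow> nat list set" where
  "partitions_within S = {\<pi>\<in>partitions. set \<pi> \<subseteq> S}"

lemma partitions_within_subset: "partitions_within S \<subseteq> partitions"
  by (auto simp: partitions_within_def)

section \<open>Generating functions of sets of partitions\<close>

lemma partition_gf_Un:
  assumes "A \<subseteq> partitions" "B \<subseteq> partitions" "A \<inter> B = {}"
  shows "partition_gf (A \<union> B) = partition_gf A + partition_gf B"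
proof (rule fps_ext)
  fix n
  have fin: "finite {\<pi>\<in>C. sum_list \<pi> = n}" if "C \<subseteq> partitions" for C
    by (rule finite_subset[OF _ finite_partitions_of[of n]]) (use that in auto)
  have "{\<pi>\<in>A \<union> B. sum_list \<pi> = n} = {\<pi>\<in>A. sum_list \<pi> = n} \<union> {\<pi>\<in>B. sum_list \<pi> = n}"
    by auto
  hence "card {\<pi>\<in>A \<union> B. sum_list \<pi> = n} = card {\<pi>\<in>A. sum_list \<pi> = n} + card {\<pi>\<in>B. sum_list \<pi> = n}"
    using fin[OF assms(1)] fin[OF assms(2)] assms(3) by (simp add: card_Un_disjoint disjoint_iff)
  thus "fps_nth (partition_gf (A \<union> B)) n = fps_nth (partition_gf A + partition_gf B) n"
    using assms by (simp add: fps_nth_partition_gf)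
qed

lemma partition_gf_Cons:
  assumes "A \<subseteq> partitions" "(#) x ` A \<subseteq> partitions"
  shows "partition_gf ((#) x ` A) = fps_X ^ x * partition_gf A"
proof (rule fps_ext)
  fix n
  \<comment> \<open>Subtraction on naturals truncates, so the case \<open>n < x\<close>, where no
    list qualifies, is split off.\<close>
  have "{\<pi>\<in>(#) x ` A. sum_list \<pi> = n} = (if n < x then {} else (#) x ` {\<pi>\<in>A. sum_list \<pi> = n - x})"
    by auto
  hence "card {\<pi>\<in>(#) x ` A. sum_list \<pi> = n} = (if n < x then 0 else card {\<pi>\<in>A. sum_list \<pi> = n - x})"
    by (simp add: card_image)
  thus "fps_nth (partition_gf ((#) x ` A)) n = fps_nth (fps_X ^ x * partition_gf A) n"
    using assms by (simp add: fps_nth_partition_gf fps_X_power_mult_nth)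
qed

lemma partition_gf_Nil: "partition_gf {[]} = 1"
  by (simp add: partition_gf_def)

lemma fps_nth_partition_gf_eq_0:
  assumes "A \<subseteq> partitions" "\<And>\<pi>. \<pi> \<in> A \<Longrightarrow> n < sum_list \<pi>"
  shows "fps_nth (partition_gf A) n = 0"
proof -
  have "{\<pi>\<in>A. sum_list \<pi> = n} = {}"
    using assms(2) by auto
  thus ?thesis
    using assms(1) by (simp only: fps_nth_partition_gf card.empty of_nat_0)
qed

section \<open>Product formula for parts in an interval\<close>

text \<open>Lists are weakly decreasing and \<open>b\<close> exceeds all of \<open>S\<close>, so a
  partition that uses \<open>b\<close> has it at the head, and the tail is again an arbitrary
  partition of the same kind.\<close>

lemma partitions_within_insert_max:
  assumes "0 < b" "\<And>x. x \<in> S \<Longrightarrow> x < b"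
  shows "partitions_within (insert b S) =
    partitions_within S \<union> (#) b ` partitions_within (insert b S)" (is "?A = ?B \<union> ?C")
proof (rule set_eqI)
  fix \<pi>
  show "\<pi> \<in> ?A \<longleftrightarrow> \<pi> \<in> ?B \<union> ?C"
  proof (cases \<pi>)
    case Nil
    thus ?thesis by (simp add: partitions_within_def partitions_def)
  next
    case (Cons x xs)
    show ?thesis
    proof (cases "x = b")
      case True
      have "b \<notin> S" using assms(2) by blast
      moreover have "y \<le> b" if "y \<in> set xs" "set xs \<subseteq> insert b S" for y
        using that assms(2) by (auto simp: less_imp_le)
      ultimately show ?thesis
        using Cons True assms(1) by (auto simp: partitions_within_def partitions_def)
    next
      case False
      have "b \<notin> set xs" if "x \<in> S" "\<forall>y\<in>set xs. y \<le> x"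
        using that assms(2) by (meson linorder_not_less)
      with False show ?thesis
        using Cons by (auto simp: partitions_within_def partitions_def)
    qed
  qed
qed

text \<open>The recursion on sets becomes F = F' + q^b F. It is unfolded only once, since its left
  side recurs on the right.\<close>

lemma partition_gf_within_insert_max:
  assumes "0 < b" "\<And>x. x \<in> S \<Longrightarrow> x < b"
  shows "partition_gf (partitions_within (insert b S)) * (1 - fps_X ^ b) =
    partition_gf (partitions_within S)"
proof -
  let ?C = "(#) b ` partitions_within (insert b S)"
  have sub: "?C \<subseteq> partitions"
    using partitions_within_insert_max[OF assms] partitions_within_subset by blast
  have "partitions_within S \<inter> ?C = {}"
    using assms(2) by (fastforce simp: partitions_within_def)
  hence "partition_gf (partitions_within (insert b S)) =
      partition_gf (partitions_within S) + partition_gf ?C"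
    by (subst partitions_within_insert_max[OF assms])
      (simp_all add: partition_gf_Un partitions_within_subset sub)
  also have "partition_gf ?C = fps_X ^ b * partition_gf (partitions_within (insert b S))"
    using sub by (intro partition_gf_Cons partitions_within_subset)
  finally show ?thesis
    by (simp add: algebra_simps)
qed

lemma qpoch_Suc: "qpoch a q (Suc n) = qpoch a q n * (1 - a * q ^ n)"
  by (simp add: qpoch_def)

lemma qpoch_Suc_left: "qpoch a q (Suc n) = (1 - a) * qpoch (a * q) q n"
  unfolding qpoch_def by (subst prod.lessThan_Suc_shift) (simp add: mult.assoc)

text \<open>Induction on the interval length: admitting the new largest part \<open>a + n\<close> is
  compensated by the new last factor 1 - q^(a+n).\<close>

lemma partition_gf_interval_mult_qpoch:
  assumes "0 < a"
  shows "partition_gf (partitions_within {a..<a + n}) * qpoch (fps_X ^ a) fps_X n = 1"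
proof (induction n)
  case 0
  have "partitions_within {} = {[]}"
    by (auto simp: partitions_within_def partitions_def)
  thus ?case by (simp add: qpoch_def partition_gf_Nil)
next
  case (Suc n)
  have "partition_gf (partitions_within {a..<a + Suc n}) * qpoch (fps_X ^ a) fps_X (Suc n) =
    (partition_gf (partitions_within (insert (a + n) {a..<a + n})) * (1 - fps_X ^ (a + n)))
      * qpoch (fps_X ^ a) fps_X n"
    by (simp add: qpoch_Suc power_add atLeastLessThanSuc mult_ac)
  also have "\<dots> = 1"
    using assms Suc by (subst partition_gf_within_insert_max) auto
  finally show ?case .
qed

text \<open>The product formula exhibits an inverse, so the quotients in \<open>H\<close> turn into
  generating functions.\<close>

lemma divide_qpoch:
  assumes "0 < a"
  shows "x / qpoch (fps_X ^ a) fps_X n = x * partition_gf (partitions_within {a..<a + n})"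
proof -
  let ?Q = "qpoch (fps_X ^ a) fps_X n :: rat fps"
  have *: "partition_gf (partitions_within {a..<a + n}) * ?Q = 1"
    by (rule partition_gf_interval_mult_qpoch[OF assms])
  hence "?Q \<noteq> 0" by auto
  hence "(x * partition_gf (partitions_within {a..<a + n})) * ?Q / ?Q =
      x * partition_gf (partitions_within {a..<a + n})"
    by (rule nonzero_mult_div_cancel_right)
  thus ?thesis by (simp add: mult.assoc *)
qed

text \<open>The least part is not at the head of the list, so it is removed algebraically: 1 - q^a
  is the first factor of the Pochhammer product.\<close>

lemma partition_gf_interval_drop_least:
  assumes "0 < a"
  shows "partition_gf (partitions_within {a..<a + Suc n}) * (1 - fps_X ^ a) =
    partition_gf (partitions_within {Suc a..<Suc a + n})" (is "?U * _ = ?V")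
proof -
  let ?Q = "qpoch (fps_X ^ Suc a) fps_X n :: rat fps"
  \<comment> \<open>Insert \<open>?V * ?Q\<close>, which equals 1; its factor \<open>?Q\<close> then
    completes the product that inverts \<open>?U\<close>.\<close>
  have "?U * (1 - fps_X ^ a) = ?U * (1 - fps_X ^ a) * (?V * ?Q)"
    by (subst partition_gf_interval_mult_qpoch) simp_all
  also have "\<dots> = (?U * qpoch (fps_X ^ a) fps_X (Suc n)) * ?V"
    by (simp add: qpoch_Suc_left mult_ac)
  also have "\<dots> = ?V"
    using assms by (subst partition_gf_interval_mult_qpoch) simp_all
  finally show ?thesis .
qed

section \<open>Fixed smallest part and bounded spread\<close>

text \<open>Among partitions with parts from s to s + L, those containing s form the first set; the
  others, including the empty one, form the second.\<close>

lemma spread_le_eq: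
  "{\<pi>\<in>partitions. \<pi> \<noteq> [] \<and> smallest_part \<pi> = s \<and> largest_part \<pi> - smallest_part \<pi> \<le> L}
    \<union> partitions_within {Suc s..<Suc s + L} = partitions_within {s..<s + Suc L}"
  (is "?A \<union> ?B = ?C")
proof (rule set_eqI)
  fix \<pi>
  show "\<pi> \<in> ?A \<union> ?B \<longleftrightarrow> \<pi> \<in> ?C"
  proof (cases "\<pi> = []")
    case True
    thus ?thesis by (simp add: partitions_within_def)
  next
    case False
    hence ge: "set \<pi> \<subseteq> {k..} \<longleftrightarrow> k \<le> smallest_part \<pi>"
      and le: "set \<pi> \<subseteq> {..<k} \<longleftrightarrow> largest_part \<pi> < k" for k
      by (auto simp: smallest_part_def largest_part_def)
    have "set \<pi> \<subseteq> {i..<j} \<longleftrightarrow> i \<le> smallest_part \<pi> \<and> largest_part \<pi> < j" for i j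
      unfolding ge[symmetric] le[symmetric] by auto
    moreover have "smallest_part \<pi> \<le> largest_part \<pi>"
      using False by (simp add: smallest_part_def largest_part_def)
    ultimately show ?thesis
      using False by (auto simp: partitions_within_def)
  qed
qed

lemma partition_gf_smallest_part:
  "partition_gf {\<pi>\<in>partitions. \<pi> \<noteq> [] \<and> smallest_part \<pi> = s
      \<and> largest_part \<pi> - smallest_part \<pi> \<le> L} =
    partition_gf (partitions_within {s..<s + Suc L})
      - partition_gf (partitions_within {Suc s..<Suc s + L})"
proof -
  let ?A = "{\<pi>\<in>partitions. \<pi> \<noteq> [] \<and> smallest_part \<pi> = s
      \<and> largest_part \<pi> - smallest_part \<pi> \<le> L}"
  have "?A \<inter> partitions_within {Suc s..<Suc s + L} = {}"
  proof -
    have "s \<in> set \<pi>" if "\<pi> \<in> ?A" for \<pi>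
      using that Min_in[of "set \<pi>"] by (auto simp: smallest_part_def)
    moreover have "s \<notin> set \<pi>" if "\<pi> \<in> partitions_within {Suc s..<Suc s + L}" for \<pi>
      using that by (auto simp: partitions_within_def)
    ultimately show ?thesis by blast
  qed
  hence "partition_gf (partitions_within {s..<s + Suc L}) =
      partition_gf ?A + partition_gf (partitions_within {Suc s..<Suc s + L})"
    unfolding spread_le_eq[symmetric] by (intro partition_gf_Un partitions_within_subset) auto
  thus ?thesis by simp
qed

lemma partition_gf_smallest_part_closed:
  assumes "0 < s"
  shows "partition_gf {\<pi>\<in>partitions. \<pi> \<noteq> [] \<and> smallest_part \<pi> = s
      \<and> largest_part \<pi> - smallest_part \<pi> \<le> L} =
    fps_X ^ s * partition_gf (partitions_within {s..<s + Suc L})"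
  unfolding partition_gf_smallest_part partition_gf_interval_drop_least[OF assms, symmetric]
  by (simp add: algebra_simps)

text \<open>Rests on q^s (1 - q^L) = (1 - q^(s+L)) - (1 - q^s): applied to the series for parts from
  s to s + L, the first factor drops the largest part and the second the least.\<close>

lemma partition_gf_smallest_part_telescope:
  assumes "0 < s"
  shows "partition_gf {\<pi>\<in>partitions. \<pi> \<noteq> [] \<and> smallest_part \<pi> = s
      \<and> largest_part \<pi> - smallest_part \<pi> \<le> L} * (1 - fps_X ^ L) =
    partition_gf (partitions_within {s..<s + L})
      - partition_gf (partitions_within {Suc s..<Suc s + L})"
proof -
  have "partition_gf (partitions_within {s..<s + Suc L}) * (1 - fps_X ^ (s + L)) =
      partition_gf (partitions_within {s..<s + L})"
    using assms partition_gf_within_insert_max[of "s + L" "{s..<s + L}"]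
    by (simp add: atLeastLessThanSuc)
  thus ?thesis
    unfolding partition_gf_smallest_part_closed[OF assms]
      partition_gf_interval_drop_least[OF assms, symmetric]
    by (simp add: algebra_simps power_add)
qed

section \<open>Telescoping over the smallest part\<close>

lemma partition_gf_smallest_part_ge_Suc:
  "partition_gf {\<pi>\<in>partitions. \<pi> \<noteq> [] \<and> smallest_part \<pi> \<ge> s
      \<and> largest_part \<pi> - smallest_part \<pi> \<le> L} =
    partition_gf {\<pi>\<in>partitions. \<pi> \<noteq> [] \<and> smallest_part \<pi> = s
      \<and> largest_part \<pi> - smallest_part \<pi> \<le> L} +
    partition_gf {\<pi>\<in>partitions. \<pi> \<noteq> [] \<and> smallest_part \<pi> \<ge> Suc s
      \<and> largest_part \<pi> - smallest_part \<pi> \<le> L}"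
  by (subst partition_gf_Un[symmetric]) (auto intro!: arg_cong[of _ _ partition_gf])

lemma sum_list_ge_if_parts_ge:
  fixes \<pi> :: "nat list"
  assumes "\<pi> \<noteq> []" "set \<pi> \<subseteq> {s..}"
  shows "s \<le> sum_list \<pi>"
  using assms by (cases \<pi>) auto

text \<open>In place of an infinite sum, the difference \<open>E j\<close> of the two sides is shown
  to be independent of \<open>j\<close>, while its coefficient at \<open>n\<close> vanishes once
  \<open>j > n\<close>.\<close>

lemma partition_gf_smallest_part_ge:
  assumes "0 < s"
  shows "partition_gf {\<pi>\<in>partitions. \<pi> \<noteq> [] \<and> smallest_part \<pi> \<ge> s
      \<and> largest_part \<pi> - smallest_part \<pi> \<le> L} * (1 - fps_X ^ L) =
    partition_gf (partitions_within {s..<s + L}) - 1"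
proof (rule fps_ext)
  fix n
  define T where "T j = {\<pi>\<in>partitions. \<pi> \<noteq> [] \<and> smallest_part \<pi> \<ge> j
      \<and> largest_part \<pi> - smallest_part \<pi> \<le> L}" for j
  define E where "E j = partition_gf (T j) * (1 - fps_X ^ L)
      - (partition_gf (partitions_within {j..<j + L}) - 1)" for j
  have E_add: "E (s + k) = E s" for k
  proof (induction k)
    case (Suc k)
    have "E (s + Suc k) = E (s + k)"
      using partition_gf_smallest_part_telescope[of "s + k" L] assms
      unfolding E_def T_def
      \<comment> \<open>The second occurrence is the one at \<open>s + k\<close>; splitting it
        produces the tail at \<open>s + Suc k\<close>.\<close>
      by (subst (2) partition_gf_smallest_part_ge_Suc) (simp add: algebra_simps)
    thus ?case using Suc by simp
  qed simp
  define j where "j = s + n"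
  have "n < j" using assms by (simp add: j_def)
  \<comment> \<open>All \<open>m \<le> n\<close> are covered because the factor 1 - q^L also brings
    in the coefficient at \<open>n - L\<close>.\<close>
  have T0: "fps_nth (partition_gf (T j)) m = 0" if "m \<le> n" for m
  proof (rule fps_nth_partition_gf_eq_0)
    fix \<pi> assume "\<pi> \<in> T j"
    hence "j \<le> sum_list \<pi>"
      by (intro sum_list_ge_if_parts_ge) (auto simp: T_def smallest_part_def)
    thus "m < sum_list \<pi>" using that \<open>n < j\<close> by simp
  qed (auto simp: T_def)
  \<comment> \<open>The empty partition accounts for the 1 in \<open>E j\<close>; every other one
    has size at least \<open>j\<close>.\<close>
  have U: "partition_gf (partitions_within {j..<j + L}) =
      1 + partition_gf (partitions_within {j..<j + L} - {[]})"
    unfolding partition_gf_Nil[symmetric]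
    by (subst partition_gf_Un[symmetric])
      (auto simp: partitions_within_def partitions_def intro!: arg_cong[of _ _ partition_gf])
  have "fps_nth (partition_gf (partitions_within {j..<j + L} - {[]})) n = 0"
  proof (rule fps_nth_partition_gf_eq_0)
    fix \<pi> assume "\<pi> \<in> partitions_within {j..<j + L} - {[]}"
    hence "j \<le> sum_list \<pi>"
      by (intro sum_list_ge_if_parts_ge) (auto simp: partitions_within_def)
    thus "n < sum_list \<pi>" using \<open>n < j\<close> by simp
  qed (auto simp: partitions_within_def)
  hence "fps_nth (E j) n = 0"
    unfolding E_def U by (simp add: right_diff_distrib fps_X_power_mult_right_nth T0)
  hence "fps_nth (E s) n = 0"
    by (simp add: j_def E_add)
  thus "fps_nth (partition_gf {\<pi>\<in>partitions. \<pi> \<noteq> [] \<and> smallest_part \<pi> \<ge> s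
      \<and> largest_part \<pi> - smallest_part \<pi> \<le> L} * (1 - fps_X ^ L)) n =
    fps_nth (partition_gf (partitions_within {s..<s + L}) - 1) n"
    by (simp add: E_def T_def)
qed

theorem theorem3:
  fixes L s :: nat
  assumes "0 < L" and "0 < s"
  shows "G L s = H L s L / (1 - fps_X ^ L)"
proof -
  \<comment> \<open>The first sum of \<open>G\<close> has the closed form q^s / (q^s; q)_(L+1); the
    second is the telescoped tail starting at s + 1.\<close>
  have "G L s * (1 - fps_X ^ L) = H L s L"
    using partition_gf_smallest_part_ge[of "Suc s" L]
    unfolding G_def H_def left_diff_distrib
    by (simp add: divide_qpoch assms(2) partition_gf_smallest_part_closed
      algebra_simps del: power_Suc)
  \<comment> \<open>For \<open>L > 0\<close> the constant coefficient is 1, so the factor can be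
    cancelled.\<close>
  moreover have "1 - fps_X ^ L \<noteq> (0 :: rat fps)"
    using \<open>0 < L\<close> by (auto dest: arg_cong[of _ _ "\<lambda>f. fps_nth f 0"])
  ultimately show ?thesis
    by (metis nonzero_mult_div_cancel_right)
qed

end
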